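(* Let $H$ be a separable Hilbert space, let $T>0$, and suppose that $f:[0,T]\times H\to H$ satisfies: (F1) $f(\cdot,x)$ is measurable for every $x\in H$; (F2) $f(t,\cdot)$ is demicontinuous in $H$ for every fixed $t\in[0,T]$; (F3) there exist $a>0$ and $b\in L^2([0,T],\mathbb{R}_+)$ such that $\|f(t,x)\|_H\le a\|x\|_H+b(t)$ for all $t\in[0,T]$, $x\in H$. Then the superposition operator $N_f:L^2([0,T],H)\to L^2([0,T],H)$ given by $N_f(u)(t):=f(t,u(t))$ is well-defined and maps bounded sets into bounded sets; moreover $N_f$ is demicontinuous.
   Context: A map $F:X\to Y$ between Banach spaces is demicontinuous if, whenever $x_n\to x$ strongly in $X$, $F(x_n)\rightharpoonup F(x)$ weakly in $Y$. *)

theory Defs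
  imports "HOL-Analysis.Analysis"
begin

text \<open>
  The spaces \<open>L\<^sup>2([0,T],H)\<close> depend on the number \<open>T\<close> and hence are not types.  Normed spaces are
  therefore explicit structures, and a normed type is turned into one by \<open>type_space\<close>, so that
  a single definition of demicontinuity serves for maps on \<open>H\<close> and on \<open>L\<^sup>2([0,T],H)\<close>.
\<close>

record 'v nspace =
  vcarrier :: "'v set"
  vadd :: "'v \<Rightarrow> 'v \<Rightarrow> 'v"
  vscale :: "real \<Rightarrow> 'v \<Rightarrow> 'v"
  vnorm :: "'v \<Rightarrow> real"

definition type_space :: "'v::real_normed_vector nspace" where
  "type_space = \<lparr>vcarrier = UNIV, vadd = (+), vscale = (*\<^sub>R), vnorm = norm\<rparr>"

definition vdiff :: "'v nspace \<Rightarrow> 'v \<Rightarrow> 'v \<Rightarrow> 'v" where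
  "vdiff X x y = vadd X x (vscale X (-1) y)"

definition strongly_converges :: "'v nspace \<Rightarrow> (nat \<Rightarrow> 'v) \<Rightarrow> 'v \<Rightarrow> bool" where
  "strongly_converges X x l \<longleftrightarrow>
     range x \<subseteq> vcarrier X \<and> l \<in> vcarrier X \<and> (\<lambda>n. vnorm X (vdiff X (x n) l)) \<longlonglongrightarrow> 0"

text \<open>Continuous linear functionals; only the values on the carrier matter.\<close>

definition dual :: "'v nspace \<Rightarrow> ('v \<Rightarrow> real) set" where
  "dual X = {\<phi>. (\<forall>x\<in>vcarrier X. \<forall>y\<in>vcarrier X. \<phi> (vadd X x y) = \<phi> x + \<phi> y) \<and>
                (\<forall>c. \<forall>x\<in>vcarrier X. \<phi> (vscale X c x) = c * \<phi> x) \<and>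
                (\<exists>C. \<forall>x\<in>vcarrier X. \<bar>\<phi> x\<bar> \<le> C * vnorm X x)}"

definition weakly_converges :: "'v nspace \<Rightarrow> (nat \<Rightarrow> 'v) \<Rightarrow> 'v \<Rightarrow> bool" where
  "weakly_converges X x l \<longleftrightarrow>
     range x \<subseteq> vcarrier X \<and> l \<in> vcarrier X \<and> (\<forall>\<phi>\<in>dual X. (\<lambda>n. \<phi> (x n)) \<longlonglongrightarrow> \<phi> l)"

definition demicontinuous :: "'v nspace \<Rightarrow> 'w nspace \<Rightarrow> ('v \<Rightarrow> 'w) \<Rightarrow> bool" where
  "demicontinuous X Y F \<longleftrightarrow> F \<in> vcarrier X \<rightarrow> vcarrier Y \<and>
     (\<forall>x l. strongly_converges X x l \<longrightarrow> weakly_converges Y (\<lambda>n. F (x n)) (F l))"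

definition vbounded :: "'v nspace \<Rightarrow> 'v set \<Rightarrow> bool" where
  "vbounded X B \<longleftrightarrow> B \<subseteq> vcarrier X \<and> (\<exists>R. \<forall>x\<in>B. vnorm X x \<le> R)"

lemma type_space_simps [simp]:
  "vcarrier type_space = UNIV" "vadd type_space = (+)"
  "vscale type_space = (*\<^sub>R)" "vnorm type_space = norm"
  by (simp_all add: type_space_def)

lemma strongly_converges_type_space:
  "strongly_converges type_space x l \<longleftrightarrow> x \<longlonglongrightarrow> l"
  by (simp add: strongly_converges_def vdiff_def tendsto_norm_zero_iff LIM_zero_iff)

lemma dual_type_space: "dual type_space = Collect bounded_linear"
proof -
  have "\<phi> \<in> dual type_space \<longleftrightarrow> bounded_linear \<phi>" for \<phi> :: "'a \<Rightarrow> real"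
    by (auto simp: dual_def bounded_linear_def bounded_linear_axioms_def linear_iff mult.commute)
  then show ?thesis by blast
qed

lemma vbounded_type_space: "vbounded type_space B \<longleftrightarrow> bounded B"
  by (simp add: vbounded_def bounded_iff)

text \<open>
  Square-integrable functions.  The codomain is assumed separable, so that Borel measurability
  and strong (Bochner) measurability coincide.  For \<open>M = lebesgue_on {0..T}\<close> the values outside
  \<open>[0,T]\<close> are irrelevant, and they are forgotten in the quotient by \<open>L2_rel M\<close>.
\<close>

definition L2_fun :: "'a measure \<Rightarrow> ('a \<Rightarrow> 'b::{real_normed_vector, second_countable_topology}) set" where
  "L2_fun M = {u \<in> borel_measurable M. integrable M (\<lambda>t. (norm (u t))\<^sup>2)}"

definition L2_rel ::
    "'a measure \<Rightarrow> (('a \<Rightarrow> 'b::{real_normed_vector, second_countable_topology}) \<times> ('a \<Rightarrow> 'b)) set" where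
  "L2_rel M = {(u, v). u \<in> L2_fun M \<and> v \<in> L2_fun M \<and> (AE t in M. u t = v t)}"

definition L2_class ::
    "'a measure \<Rightarrow> ('a \<Rightarrow> 'b::{real_normed_vector, second_countable_topology}) \<Rightarrow> ('a \<Rightarrow> 'b) set" where
  "L2_class M u = L2_rel M `` {u}"

definition L2_space ::
    "'a measure \<Rightarrow> ('a \<Rightarrow> 'b::{real_normed_vector, second_countable_topology}) set nspace" where
  "L2_space M =
     \<lparr>vcarrier = L2_fun M // L2_rel M,
      vadd = (\<lambda>U V. \<Union>u\<in>U. \<Union>v\<in>V. L2_class M (\<lambda>t. u t + v t)),
      vscale = (\<lambda>c U. \<Union>u\<in>U. L2_class M (\<lambda>t. c *\<^sub>R u t)),
      vnorm = (\<lambda>U. the_elem ((\<lambda>u. sqrt (\<integral>t. (norm (u t))\<^sup>2 \<partial>M)) ` U))\<rparr>"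

definition superpos :: "('a \<Rightarrow> 'b \<Rightarrow> 'c) \<Rightarrow> ('a \<Rightarrow> 'b) \<Rightarrow> 'a \<Rightarrow> 'c" where
  "superpos f u = (\<lambda>t. f t (u t))"

text \<open>
  The operator induced on equivalence classes; it is meaningful when \<open>superpos f\<close> preserves
  square integrability and respects \<open>L2_rel M\<close>.
\<close>

definition superpos_op :: "'a measure \<Rightarrow>
    ('a \<Rightarrow> 'b::{real_normed_vector, second_countable_topology} \<Rightarrow>
      'c::{real_normed_vector, second_countable_topology}) \<Rightarrow> ('a \<Rightarrow> 'b) set \<Rightarrow> ('a \<Rightarrow> 'c) set" where
  "superpos_op M f U = (\<Union>u\<in>U. L2_class M (superpos f u))"

lemma equiv_L2_rel: "equiv (L2_fun M) (L2_rel M)"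
proof (rule equivI)
  show "refl_on (L2_fun M) (L2_rel M)" by (auto simp: refl_on_def L2_rel_def)
  show "sym (L2_rel M)" by (force intro!: symI simp: L2_rel_def)
  show "L2_rel M \<subseteq> L2_fun M \<times> L2_fun M" by (auto simp: L2_rel_def)
  show "trans (L2_rel M)"
  proof (rule transI)
    fix u v w assume "(u, v) \<in> L2_rel M" "(v, w) \<in> L2_rel M"
    then have "u \<in> L2_fun M" "w \<in> L2_fun M" and e: "AE t in M. u t = v t" "AE t in M. v t = w t"
      by (auto simp: L2_rel_def)
    moreover have "AE t in M. u t = w t" using e by eventually_elim simp
    ultimately show "(u, w) \<in> L2_rel M" by (simp add: L2_rel_def)
  qed
qed

lemma L2_fun_add:
  assumes "u \<in> L2_fun M" "v \<in> L2_fun M"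
  shows "(\<lambda>t. u t + v t) \<in> L2_fun M"
proof -
  have m: "u \<in> borel_measurable M" "v \<in> borel_measurable M"
    using assms by (auto simp: L2_fun_def)
  have i: "integrable M (\<lambda>t. 2 * (norm (u t))\<^sup>2 + 2 * (norm (v t))\<^sup>2)"
    using assms by (auto simp: L2_fun_def)
  have le: "(norm (u t + v t))\<^sup>2 \<le> 2 * (norm (u t))\<^sup>2 + 2 * (norm (v t))\<^sup>2" for t
  proof -
    have "(norm (u t + v t))\<^sup>2 \<le> (norm (u t) + norm (v t))\<^sup>2"
      by (intro power_mono norm_triangle_ineq) simp
    also have "\<dots> \<le> 2 * (norm (u t))\<^sup>2 + 2 * (norm (v t))\<^sup>2"
      using sum_squares_bound[of "norm (u t)" "norm (v t)"] by (simp add: power2_sum)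
    finally show ?thesis .
  qed
  have "integrable M (\<lambda>t. (norm (u t + v t))\<^sup>2)"
    by (rule Bochner_Integration.integrable_bound[OF i]) (use m le in \<open>auto simp: abs_le_iff\<close>)
  then show ?thesis using m by (simp add: L2_fun_def)
qed

lemma L2_fun_scale: "u \<in> L2_fun M \<Longrightarrow> (\<lambda>t. c *\<^sub>R u t) \<in> L2_fun M"
  by (auto simp: L2_fun_def power_mult_distrib)

lemma L2_class_eqI: "(u, v) \<in> L2_rel M \<Longrightarrow> L2_class M u = L2_class M v"
  unfolding L2_class_def by (rule equiv_class_eq[OF equiv_L2_rel])

lemma L2_class_self: "u \<in> L2_fun M \<Longrightarrow> u \<in> L2_class M u"
  unfolding L2_class_def by (rule equiv_class_self[OF equiv_L2_rel])

lemma L2_class_iff: "v \<in> L2_class M u \<longleftrightarrow> (u, v) \<in> L2_rel M"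
  by (simp add: L2_class_def)

lemma L2_class_carrier: "u \<in> L2_fun M \<Longrightarrow> L2_class M u \<in> vcarrier (L2_space M)"
  by (simp add: L2_space_def L2_class_def quotientI)

lemma L2_add_class:
  assumes "u \<in> L2_fun M" "v \<in> L2_fun M"
  shows "vadd (L2_space M) (L2_class M u) (L2_class M v) = L2_class M (\<lambda>t. u t + v t)"
proof -
  have "L2_class M (\<lambda>t. u' t + v' t) = L2_class M (\<lambda>t. u t + v t)"
    if "u' \<in> L2_class M u" "v' \<in> L2_class M v" for u' v'
  proof (rule L2_class_eqI)
    have e: "AE t in M. u t = u' t" "AE t in M. v t = v' t" and "u' \<in> L2_fun M" "v' \<in> L2_fun M"
      using that by (auto simp: L2_class_iff L2_rel_def)
    moreover have "AE t in M. u' t + v' t = u t + v t" using e by eventually_elim simp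
    ultimately show "(\<lambda>t. u' t + v' t, \<lambda>t. u t + v t) \<in> L2_rel M"
      using assms by (simp add: L2_rel_def L2_fun_add)
  qed
  then have inner: "(\<Union>v'\<in>L2_class M v. L2_class M (\<lambda>t. u' t + v' t)) = L2_class M (\<lambda>t. u t + v t)"
    if "u' \<in> L2_class M u" for u'
    using that L2_class_self[OF assms(2)] by (intro SUP_eq_const) blast+
  then have "(\<Union>u'\<in>L2_class M u. \<Union>v'\<in>L2_class M v. L2_class M (\<lambda>t. u' t + v' t)) =
      L2_class M (\<lambda>t. u t + v t)"
    by (intro SUP_eq_const inner) (use L2_class_self[OF assms(1)] in \<open>rule ex_in_conv[THEN iffD1, OF exI]\<close>)
  then show ?thesis by (simp add: L2_space_def)
qed

lemma L2_scale_class: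
  assumes "u \<in> L2_fun M"
  shows "vscale (L2_space M) c (L2_class M u) = L2_class M (\<lambda>t. c *\<^sub>R u t)"
proof -
  have "L2_class M (\<lambda>t. c *\<^sub>R u' t) = L2_class M (\<lambda>t. c *\<^sub>R u t)"
    if "u' \<in> L2_class M u" for u'
  proof (rule L2_class_eqI)
    have e: "AE t in M. u t = u' t" and "u' \<in> L2_fun M"
      using that by (auto simp: L2_class_iff L2_rel_def)
    moreover have "AE t in M. c *\<^sub>R u' t = c *\<^sub>R u t" using e by eventually_elim simp
    ultimately show "(\<lambda>t. c *\<^sub>R u' t, \<lambda>t. c *\<^sub>R u t) \<in> L2_rel M"
      using assms by (simp add: L2_rel_def L2_fun_scale)
  qed
  then have "(\<Union>u'\<in>L2_class M u. L2_class M (\<lambda>t. c *\<^sub>R u' t)) = L2_class M (\<lambda>t. c *\<^sub>R u t)"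
    using L2_class_self[OF assms] by (intro SUP_eq_const) blast+
  then show ?thesis by (simp add: L2_space_def)
qed

lemma L2_norm_class:
  assumes "u \<in> L2_fun M"
  shows "vnorm (L2_space M) (L2_class M u) = sqrt (\<integral>t. (norm (u t))\<^sup>2 \<partial>M)"
proof -
  have "(\<integral>t. (norm (u' t))\<^sup>2 \<partial>M) = (\<integral>t. (norm (u t))\<^sup>2 \<partial>M)" if "u' \<in> L2_class M u" for u'
    using that by (intro integral_cong_AE) (auto simp: L2_class_iff L2_rel_def L2_fun_def)
  then have "(\<lambda>u. sqrt (\<integral>t. (norm (u t))\<^sup>2 \<partial>M)) ` L2_class M u =
      (\<lambda>_. sqrt (\<integral>t. (norm (u t))\<^sup>2 \<partial>M)) ` L2_class M u"
    by (intro image_cong refl) (simp only:)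
  also have "\<dots> = {sqrt (\<integral>t. (norm (u t))\<^sup>2 \<partial>M)}"
    using L2_class_self[OF assms] by (intro image_constant)
  finally show ?thesis by (simp add: L2_space_def)
qed

end

theory Submission
  imports Defs
begin

text \<open>
  For simple \<open>s\<^sub>i \<rightarrow> u\<close>, the measurable functions \<open>f(t, s\<^sub>i(t))\<close> converge weakly to \<open>f(t, u(t))\<close>, so
  the limit is measurable by Pettis' theorem; the growth condition then bounds its norm.  For
  demicontinuity, a functional on \<open>L\<^sup>2\<close> is within a small multiple of the norm of some
  \<open>\<langle>w, \<cdot>\<rangle>\<close>, and the images \<open>N\<^sub>f(u\<^sub>n)\<close> are bounded, so it suffices that
  \<open>\<langle>w, N\<^sub>f(u\<^sub>n) - N\<^sub>f(u)\<rangle> \<rightarrow> 0\<close>.  Along a subsequence with \<open>u\<^sub>n \<rightarrow> u\<close> almost everywhere, the integrand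
  tends to \<open>0\<close> almost everywhere, and it is at most a fixed integrable function plus
  \<open>a \<bar>w\<bar> \<bar>u\<^sub>n - u\<bar>\<close>, whose integral tends to \<open>0\<close>.
\<close>

section \<open>Measurability\<close>

text \<open>For fixed \<open>x\<close> the vectors \<open>h\<close> violating the inequality form an
  open set, so if there is one at all then there is one in \<open>D\<close>. Hence the condition on
  \<open>D\<close> extends to every \<open>h\<close>, and \<open>h = x\<close> bounds the
  norm.\<close>

lemma norm_le_iff_inner_dense:
  fixes x :: "'b::real_inner"
  assumes D: "\<And>S::'b set. open S \<Longrightarrow> S \<noteq> {} \<Longrightarrow> \<exists>d\<in>D. d \<in> S" and "r \<ge> 0"
  shows "norm x \<le> r \<longleftrightarrow> (\<forall>h\<in>D. inner h x \<le> r * norm h)"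
proof
  assume "norm x \<le> r"
  show "\<forall>h\<in>D. inner h x \<le> r * norm h"
  proof
    fix h
    have "inner h x \<le> norm h * norm x" by (rule norm_cauchy_schwarz)
    also have "\<dots> \<le> norm h * r" using \<open>norm x \<le> r\<close> by (rule mult_left_mono) simp
    finally show "inner h x \<le> r * norm h" by (simp add: mult.commute)
  qed
next
  assume *: "\<forall>h\<in>D. inner h x \<le> r * norm h"
  have "open {h. r * norm h < inner h x}"
    by (intro open_Collect_less continuous_intros)
  with D[of "{h. r * norm h < inner h x}"] * have "inner x x \<le> r * norm x"
    by (force simp: not_less[symmetric])
  then have "norm x * norm x \<le> r * norm x"
    by (simp add: power2_norm_eq_inner[symmetric] power2_eq_square)
  then show "norm x \<le> r" using \<open>r \<ge> 0\<close> by (cases "x = 0") auto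
qed

text \<open>Pettis' theorem: every open set is a countable union of closed balls, and each closed ball is a
  countable intersection of half-spaces.\<close>

lemma borel_measurable_inner_separable:
  fixes g :: "'a \<Rightarrow> 'b::{real_inner, second_countable_topology}"
  assumes g: "\<And>h. (\<lambda>t. inner h (g t)) \<in> borel_measurable M"
  shows "g \<in> borel_measurable M"
proof (rule borel_measurableI)
  fix S :: "'b set" assume S: "open S"
  obtain D :: "'b set" where "countable D" and D: "\<And>X. open X \<Longrightarrow> X \<noteq> {} \<Longrightarrow> \<exists>d\<in>D. d \<in> X"
    by (erule countable_dense_setE)
  \<comment> \<open>\<open>I\<close> indexes the closed balls inside \<open>S\<close> with centre in
    \<open>D\<close> and rational radius; there are countably many.\<close>
  define I where "I = {(d, q). d \<in> D \<and> q \<in> \<rat> \<and> q \<ge> 0 \<and> cball d q \<subseteq> S}"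
  have "countable I"
    by (rule countable_subset[of _ "D \<times> \<rat>"]) (use \<open>countable D\<close> in \<open>auto simp: I_def countable_rat\<close>)
  have ball: "{t \<in> space M. dist d (g t) \<le> q} \<in> sets M" if "q \<ge> 0" for d q
  proof -
    have "{t \<in> space M. dist d (g t) \<le> q} =
        {t \<in> space M. \<forall>h\<in>D. inner h (g t) - inner h d \<le> q * norm h}"
      using norm_le_iff_inner_dense[OF D \<open>q \<ge> 0\<close>]
      by (simp add: dist_norm norm_minus_commute[of d] inner_diff_right)
    also have "\<dots> \<in> sets M"
    proof (rule sets.sets_Collect_countable_All'[OF _ \<open>countable D\<close>])
      fix h
      have [measurable]: "(\<lambda>t. inner h (g t)) \<in> borel_measurable M" by (rule g)
      show "{t \<in> space M. inner h (g t) - inner h d \<le> q * norm h} \<in> sets M" by measurable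
    qed
    finally show ?thesis .
  qed
  have "g -` S \<inter> space M = (\<Union>(d, q)\<in>I. {t \<in> space M. dist d (g t) \<le> q})"
  proof (intro equalityI subsetI)
    fix t assume t: "t \<in> g -` S \<inter> space M"
    then obtain e where e: "e > 0" "ball (g t) e \<subseteq> S" using S by (auto elim: openE)
    \<comment> \<open>A centre within e/3 of \<open>g t\<close> and a radius between e/3 and e/2
      make the ball contain \<open>g t\<close> and stay within 5e/6 of it, hence inside
      \<open>S\<close>.\<close>
    obtain d where d: "d \<in> D" "d \<in> ball (g t) (e/3)"
      using D[of "ball (g t) (e/3)"] e by auto
    obtain q where q: "q \<in> \<rat>" "e/3 < q" "q < e/2"
      using Rats_dense_in_real[of "e/3" "e/2"] e by auto
    have "cball d q \<subseteq> S"
    proof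
      fix y assume "y \<in> cball d q"
      then have "dist (g t) y < e"
        using dist_triangle[of "g t" y d] d q e by simp
      then show "y \<in> S" using e by auto
    qed
    moreover have "dist d (g t) \<le> q" using d q by (simp add: dist_commute)
    ultimately show "t \<in> (\<Union>(d, q)\<in>I. {t \<in> space M. dist d (g t) \<le> q})"
      using t d q e unfolding I_def by (intro UN_I[of "(d, q)"]) auto
  qed (auto simp: I_def)
  also have "\<dots> \<in> sets M"
    using ball by (intro sets.countable_UN'[OF \<open>countable I\<close>]) (auto simp: I_def)
  finally show "g -` S \<inter> space M \<in> sets M" .
qed

text \<open>Pairing with \<open>h\<close> lies in the dual of the codomain. The later arguments use
  demicontinuity of \<open>f t\<close> in this form.\<close>

lemma demicontinuous_type_space_inner:
  fixes F :: "'b::real_normed_vector \<Rightarrow> 'c::real_inner"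
  assumes "demicontinuous type_space type_space F" "x \<longlonglongrightarrow> l"
  shows "(\<lambda>n. inner h (F (x n))) \<longlonglongrightarrow> inner h (F l)"
  using assms bounded_linear_inner_right[of h]
  by (auto simp: demicontinuous_def strongly_converges_type_space weakly_converges_def dual_type_space)

lemma superpos_borel_measurable:
  fixes f :: "'a \<Rightarrow> 'b::{real_normed_vector, second_countable_topology} \<Rightarrow>
    'c::{real_inner, second_countable_topology}"
  assumes f: "\<And>x. (\<lambda>t. f t x) \<in> borel_measurable M"
    and demi: "\<And>t. t \<in> space M \<Longrightarrow> demicontinuous type_space type_space (f t)"
    and u: "u \<in> borel_measurable M"
  shows "superpos f u \<in> borel_measurable M"
proof (rule borel_measurable_inner_separable)
  fix h
  obtain s where s: "\<And>i. simple_function M (s i)" "\<And>t. t \<in> space M \<Longrightarrow> (\<lambda>i. s i t) \<longlonglongrightarrow> u t"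
    using borel_measurable_implies_sequence_metric[OF u] by metis
  \<comment> \<open>A simple function has finite range, so this map is glued from the measurable
    maps \<open>\<lambda>t. f t x\<close> along the level sets of \<open>s i\<close>; no joint
    measurability of \<open>f\<close> enters.\<close>
  have [measurable]: "(\<lambda>t. f t (s i t)) \<in> borel_measurable M" for i
  proof (rule measurable_compose_countable'[where I = "s i ` space M"])
    show "s i \<in> measurable M (count_space (s i ` space M))"
      using simple_functionD[OF s(1)] by (subst measurable_count_space_eq2) auto
    show "countable (s i ` space M)"
      using simple_functionD(1)[OF s(1)] by (rule countable_finite)
  qed (rule f)
  show "(\<lambda>t. inner h (superpos f u t)) \<in> borel_measurable M"
  proof (rule borel_measurable_LIMSEQ_real)
    show "(\<lambda>i. inner h (f t (s i t))) \<longlonglongrightarrow> inner h (superpos f u t)" if "t \<in> space M" for t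
      unfolding superpos_def using that by (intro demicontinuous_type_space_inner demi s)
  qed measurable
qed

section \<open>Square-integrable functions\<close>

lemma square_add_le: "(x + y)\<^sup>2 \<le> 2 * x\<^sup>2 + 2 * (y::real)\<^sup>2"
  using sum_squares_bound[of x y] by (simp add: power2_sum)

text \<open>A quadratic without negative values has discriminant at most 0; if the leading
  coefficient vanishes, the linear one must vanish too. It serves both the Cauchy-Schwarz inequality
  and the error bound in the approximate Riesz representation.\<close>

lemma quadratic_nonneg_imp:
  fixes a b c :: real
  assumes nonneg: "\<And>s. a * s\<^sup>2 + b * s + c \<ge> 0" and "a \<ge> 0"
  shows "b\<^sup>2 \<le> 4 * a * c"
proof (cases "a = 0")
  case True
  have "b = 0"
  proof (rule ccontr)
    assume "b \<noteq> 0"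
    \<comment> \<open>At this point the linear polynomial takes the value -1.\<close>
    with nonneg[of "- (c + 1) / b"] True show False by (simp add: field_simps)
  qed
  with True show ?thesis by simp
next
  case False
  \<comment> \<open>The vertex of the parabola.\<close>
  define s where "s = - b / (2 * a)"
  have b: "b = - (2 * a * s)" using False by (simp add: s_def)
  have "0 \<le> 4 * a * (a * s\<^sup>2 + b * s + c)"
    using nonneg[of s] \<open>a \<ge> 0\<close> by simp
  also have "\<dots> = 4 * a * c - b\<^sup>2"
    by (simp add: b power2_eq_square algebra_simps)
  finally show ?thesis by simp
qed

lemma L2_fun_diff:
  assumes "u \<in> L2_fun M" "v \<in> L2_fun M"
  shows "(\<lambda>t. u t - v t) \<in> L2_fun M"
  using L2_fun_add[OF assms(1) L2_fun_scale[OF assms(2), of "-1"]] by simp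

lemma L2_fun_norm: "u \<in> L2_fun M \<Longrightarrow> (\<lambda>t. norm (u t)) \<in> L2_fun M"
  by (auto simp: L2_fun_def)

lemma L2_fun_bound:
  assumes "g \<in> L2_fun M" "v \<in> borel_measurable M"
    and "\<And>t. t \<in> space M \<Longrightarrow> norm (v t) \<le> norm (g t)"
  shows "v \<in> L2_fun M"
proof -
  have "integrable M (\<lambda>t. (norm (v t))\<^sup>2)"
    by (rule Bochner_Integration.integrable_bound[of M "\<lambda>t. (norm (g t))\<^sup>2"])
      (use assms in \<open>auto simp: L2_fun_def intro!: AE_I2 power_mono\<close>)
  with assms(2) show ?thesis by (simp add: L2_fun_def)
qed

text \<open>A triangle inequality for squared norms, obtained pointwise; the factor 2 is harmless,
  since it serves only to show boundedness.\<close>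

lemma L2_integral_add_le:
  assumes "u \<in> L2_fun M" "v \<in> L2_fun M"
  shows "(\<integral>t. (norm (u t + v t))\<^sup>2 \<partial>M) \<le>
    2 * (\<integral>t. (norm (u t))\<^sup>2 \<partial>M) + 2 * (\<integral>t. (norm (v t))\<^sup>2 \<partial>M)"
proof -
  have "(norm (u t + v t))\<^sup>2 \<le> 2 * (norm (u t))\<^sup>2 + 2 * (norm (v t))\<^sup>2" for t
    by (rule order_trans[OF power_mono square_add_le]) (simp_all add: norm_triangle_ineq)
  then have "(\<integral>t. (norm (u t + v t))\<^sup>2 \<partial>M) \<le>
      (\<integral>t. 2 * (norm (u t))\<^sup>2 + 2 * (norm (v t))\<^sup>2 \<partial>M)"
    using assms L2_fun_add[OF assms] by (intro integral_mono) (auto simp: L2_fun_def)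
  with assms show ?thesis by (simp add: L2_fun_def)
qed

section \<open>Products of square-integrable functions and the Cauchy-Schwarz inequality\<close>

lemma integrable_norm_mult_L2:
  assumes "u \<in> L2_fun M" "v \<in> L2_fun M"
  shows "integrable M (\<lambda>t. norm (u t) * norm (v t))"
proof (rule Bochner_Integration.integrable_bound)
  show "integrable M (\<lambda>t. (norm (u t))\<^sup>2 + (norm (v t))\<^sup>2)"
    using assms by (auto simp: L2_fun_def)
  have "norm (u t) * norm (v t) \<le> (norm (u t))\<^sup>2 + (norm (v t))\<^sup>2" for t
    using sum_squares_bound[of "norm (u t)" "norm (v t)"]
      mult_nonneg_nonneg[OF norm_ge_zero[of "u t"] norm_ge_zero[of "v t"]]
    unfolding mult.assoc by linarith
  then show "AE t in M. norm (norm (u t) * norm (v t)) \<le> norm ((norm (u t))\<^sup>2 + (norm (v t))\<^sup>2)"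
    by simp
qed (use assms in \<open>auto simp: L2_fun_def\<close>)

lemma integrable_inner_L2:
  fixes u v :: "'a \<Rightarrow> 'b::{real_inner, second_countable_topology}"
  assumes "u \<in> L2_fun M" "v \<in> L2_fun M"
  shows "integrable M (\<lambda>t. inner (u t) (v t))"
proof (rule Bochner_Integration.integrable_bound[OF integrable_norm_mult_L2[OF assms]])
  show "AE t in M. norm (inner (u t) (v t)) \<le> norm (norm (u t) * norm (v t))"
    by (simp add: Cauchy_Schwarz_ineq2)
qed (use assms in \<open>auto simp: L2_fun_def\<close>)

text \<open>The coefficients of this polynomial in \<open>s\<close> are what
  \<open>quadratic_nonneg_imp\<close> is applied to.\<close>

lemma L2_inner_expand:
  fixes u v :: "'a \<Rightarrow> 'b::{real_inner, second_countable_topology}"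
  assumes "u \<in> L2_fun M" "v \<in> L2_fun M"
  shows "(\<integral>t. (norm (u t + s *\<^sub>R v t))\<^sup>2 \<partial>M) =
    (\<integral>t. (norm (v t))\<^sup>2 \<partial>M) * s\<^sup>2 + 2 * (\<integral>t. inner (u t) (v t) \<partial>M) * s + (\<integral>t. (norm (u t))\<^sup>2 \<partial>M)"
proof -
  have "(norm (x + s *\<^sub>R y))\<^sup>2 = (norm y)\<^sup>2 * s\<^sup>2 + 2 * s * inner x y + (norm x)\<^sup>2" for x y :: 'b
    unfolding power2_norm_eq_inner
    by (simp add: inner_commute[of y x] power2_eq_square algebra_simps)
  then show ?thesis
    using assms integrable_inner_L2[OF assms] by (simp add: L2_fun_def)
qed

lemma L2_Cauchy_Schwarz:
  fixes u v :: "'a \<Rightarrow> 'b::{real_inner, second_countable_topology}"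
  assumes "u \<in> L2_fun M" "v \<in> L2_fun M"
  shows "(\<integral>t. inner (u t) (v t) \<partial>M)\<^sup>2 \<le> (\<integral>t. (norm (u t))\<^sup>2 \<partial>M) * (\<integral>t. (norm (v t))\<^sup>2 \<partial>M)"
proof -
  have "(2 * (\<integral>t. inner (u t) (v t) \<partial>M))\<^sup>2 \<le>
      4 * (\<integral>t. (norm (v t))\<^sup>2 \<partial>M) * (\<integral>t. (norm (u t))\<^sup>2 \<partial>M)"
    by (rule quadratic_nonneg_imp) (simp_all add: L2_inner_expand[OF assms, symmetric])
  then show ?thesis by (simp add: power_mult_distrib mult.commute)
qed

text \<open>An approximate Riesz representation: a near-minimiser \<open>w\<close> of
  \<open>\<integral> \<bar>w\<bar>\<^sup>2 / 2 - \<psi> w\<close> represents \<open>\<psi>\<close> up to a small error, so that no completeness is needed.\<close>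

lemma L2_approx_Riesz:
  fixes \<psi> :: "('a \<Rightarrow> 'b::{real_inner, second_countable_topology}) \<Rightarrow> real"
  assumes add: "\<And>u v. u \<in> L2_fun M \<Longrightarrow> v \<in> L2_fun M \<Longrightarrow> \<psi> (\<lambda>t. u t + v t) = \<psi> u + \<psi> v"
    and scale: "\<And>c u. u \<in> L2_fun M \<Longrightarrow> \<psi> (\<lambda>t. c *\<^sub>R u t) = c * \<psi> u"
    and bound: "\<And>u. u \<in> L2_fun M \<Longrightarrow> \<bar>\<psi> u\<bar> \<le> C * sqrt (\<integral>t. (norm (u t))\<^sup>2 \<partial>M)"
    and "\<epsilon> > 0"
  obtains w where "w \<in> L2_fun M"
    "\<And>x. x \<in> L2_fun M \<Longrightarrow>
      \<bar>(\<integral>t. inner (w t) (x t) \<partial>M) - \<psi> x\<bar> \<le> \<epsilon> * sqrt (\<integral>t. (norm (x t))\<^sup>2 \<partial>M)"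
proof -
  define J where "J w = (\<integral>t. (norm (w t))\<^sup>2 \<partial>M) / 2 - \<psi> w" for w
  have below: "- (C\<^sup>2 / 2) \<le> J w" if "w \<in> L2_fun M" for w
  proof -
    define r where "r = sqrt (\<integral>t. (norm (w t))\<^sup>2 \<partial>M)"
    have "(\<integral>t. (norm (w t))\<^sup>2 \<partial>M) = r\<^sup>2" by (simp add: r_def)
    moreover have "\<psi> w \<le> C * r" using bound[OF that] by (simp add: r_def)
    \<comment> \<open>Completing the square: \<open>J w\<close> is at least r^2/2 - C r, which
      equals (r - C)^2/2 - C^2/2.\<close>
    moreover have "0 \<le> (r - C)\<^sup>2" by simp
    ultimately show ?thesis by (simp add: J_def power2_diff field_simps)
  qed
  have "(\<lambda>_. 0) \<in> (L2_fun M :: ('a \<Rightarrow> 'b) set)" by (simp add: L2_fun_def)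
  then have ne: "J ` L2_fun M \<noteq> {}" by blast
  have bdd: "bdd_below (J ` L2_fun M)" using below by (intro bdd_belowI[of _ "- (C\<^sup>2 / 2)"]) blast
  \<comment> \<open>The slack \<epsilon>^2/2 is chosen so that the discriminant bound below becomes
    exactly p^2 \<le> \<epsilon>^2 q.\<close>
  have "Inf (J ` L2_fun M) < Inf (J ` L2_fun M) + \<epsilon>\<^sup>2 / 2" using \<open>\<epsilon> > 0\<close> by simp
  from cInf_lessD[OF ne this] obtain w
    where w: "w \<in> L2_fun M" and Jw: "J w < Inf (J ` L2_fun M) + \<epsilon>\<^sup>2 / 2" by blast
  show thesis
  proof (rule that[OF w])
    fix x :: "'a \<Rightarrow> 'b" assume x: "x \<in> L2_fun M"
    define q where "q = (\<integral>t. (norm (x t))\<^sup>2 \<partial>M)"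
    define p where "p = (\<integral>t. inner (w t) (x t) \<partial>M) - \<psi> x"
    have "q \<ge> 0" by (simp add: q_def)
    \<comment> \<open>Here \<open>p\<close> is the first variation of \<open>J\<close> at
      \<open>w\<close> in direction \<open>x\<close>. Moving along \<open>x\<close> cannot lower
      \<open>J\<close> by more than the slack, so a quadratic in the step \<open>s\<close> stays
      nonnegative.\<close>
    have "p\<^sup>2 \<le> 4 * (q / 2) * (\<epsilon>\<^sup>2 / 2)"
    proof (rule quadratic_nonneg_imp)
      fix s
      have "Inf (J ` L2_fun M) \<le> J (\<lambda>t. w t + s *\<^sub>R x t)"
        by (intro cINF_lower bdd L2_fun_add L2_fun_scale w x)
      also have "\<dots> = J w + q / 2 * s\<^sup>2 + p * s"
        by (simp add: J_def L2_inner_expand[OF w x] add[OF w L2_fun_scale[OF x]] scale[OF x]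
            p_def q_def field_simps)
      finally show "0 \<le> q / 2 * s\<^sup>2 + p * s + \<epsilon>\<^sup>2 / 2" using Jw by simp
    qed (use \<open>q \<ge> 0\<close> in simp)
    then have "sqrt (p\<^sup>2) \<le> sqrt (\<epsilon>\<^sup>2 * q)"
      by (intro real_sqrt_le_mono) (simp add: mult.commute)
    then show "\<bar>(\<integral>t. inner (w t) (x t) \<partial>M) - \<psi> x\<bar> \<le> \<epsilon> * sqrt (\<integral>t. (norm (x t))\<^sup>2 \<partial>M)"
      using \<open>\<epsilon> > 0\<close> by (simp add: real_sqrt_mult p_def q_def)
  qed
qed

section \<open>The superposition operator\<close>

lemma superpos_L2_fun:
  fixes f :: "'a \<Rightarrow> 'b::{real_normed_vector, second_countable_topology} \<Rightarrow>
    'c::{real_inner, second_countable_topology}"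
  assumes f: "\<And>x. (\<lambda>t. f t x) \<in> borel_measurable M"
    and demi: "\<And>t. t \<in> space M \<Longrightarrow> demicontinuous type_space type_space (f t)"
    and growth: "\<And>t x. t \<in> space M \<Longrightarrow> norm (f t x) \<le> a * norm x + b t"
    and b: "b \<in> L2_fun M" and u: "u \<in> L2_fun M"
  shows "superpos f u \<in> L2_fun M"
proof (rule L2_fun_bound)
  show "(\<lambda>t. a *\<^sub>R norm (u t) + b t) \<in> L2_fun M"
    by (intro L2_fun_add L2_fun_scale L2_fun_norm u b)
  show "superpos f u \<in> borel_measurable M"
    using u by (intro superpos_borel_measurable f demi) (auto simp: L2_fun_def)
  show "norm (superpos f u t) \<le> norm (a *\<^sub>R norm (u t) + b t)" if "t \<in> space M" for t
    using growth[OF that, of "u t"] by (simp add: superpos_def)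
qed

text \<open>The growth condition, squared and integrated. It bounds the images of bounded sets, and
  later those of a convergent sequence.\<close>

lemma superpos_L2_bound:
  fixes f :: "'a \<Rightarrow> 'b::{real_normed_vector, second_countable_topology} \<Rightarrow>
    'c::{real_inner, second_countable_topology}"
  assumes growth: "\<And>t x. t \<in> space M \<Longrightarrow> norm (f t x) \<le> a * norm x + b t"
    and b: "b \<in> L2_fun M" and u: "u \<in> L2_fun M" and fu: "superpos f u \<in> L2_fun M"
  shows "(\<integral>t. (norm (superpos f u t))\<^sup>2 \<partial>M) \<le>
    2 * a\<^sup>2 * (\<integral>t. (norm (u t))\<^sup>2 \<partial>M) + 2 * (\<integral>t. (b t)\<^sup>2 \<partial>M)"
proof -
  have i: "integrable M (\<lambda>t. (norm (u t))\<^sup>2)" "integrable M (\<lambda>t. (b t)\<^sup>2)"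
    using b u by (auto simp: L2_fun_def)
  have "(\<integral>t. (norm (superpos f u t))\<^sup>2 \<partial>M) \<le> (\<integral>t. 2 * a\<^sup>2 * (norm (u t))\<^sup>2 + 2 * (b t)\<^sup>2 \<partial>M)"
  proof (rule integral_mono)
    fix t assume "t \<in> space M"
    then have "(norm (superpos f u t))\<^sup>2 \<le> (a * norm (u t) + b t)\<^sup>2"
      using growth by (intro power_mono) (auto simp: superpos_def)
    also have "\<dots> \<le> 2 * a\<^sup>2 * (norm (u t))\<^sup>2 + 2 * (b t)\<^sup>2"
      using square_add_le[of "a * norm (u t)" "b t"] by (simp add: power_mult_distrib)
    finally show "(norm (superpos f u t))\<^sup>2 \<le> 2 * a\<^sup>2 * (norm (u t))\<^sup>2 + 2 * (b t)\<^sup>2" .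
  qed (use fu i in \<open>auto simp: L2_fun_def\<close>)
  with i show ?thesis by simp
qed

text \<open>The integrand \<open>g\<close> is split into its truncation at \<open>d\<close>, to which dominated convergence
  applies, and an excess of at most \<open>e\<close>.\<close>

lemma integral_tendsto_zero_dominated_excess:
  fixes g e :: "nat \<Rightarrow> 'a \<Rightarrow> real"
  assumes g: "\<And>n. integrable M (g n)" and e: "\<And>n. integrable M (e n)" and d: "integrable M d"
    and lim: "AE t in M. (\<lambda>n. g n t) \<longlonglongrightarrow> 0"
    and le: "\<And>n t. t \<in> space M \<Longrightarrow> \<bar>g n t\<bar> \<le> d t + e n t"
    and nonneg: "\<And>t. t \<in> space M \<Longrightarrow> d t \<ge> 0" "\<And>n t. t \<in> space M \<Longrightarrow> e n t \<ge> 0"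
    and e0: "(\<lambda>n. \<integral>t. e n t \<partial>M) \<longlonglongrightarrow> 0"
  shows "(\<lambda>n. \<integral>t. g n t \<partial>M) \<longlonglongrightarrow> 0"
proof -
  have m [measurable]: "g n \<in> borel_measurable M" "d \<in> borel_measurable M" for n
    using g d by auto
  have min: "integrable M (\<lambda>t. min \<bar>g n t\<bar> (d t))" for n
    using g d by (intro integrable_min) auto
  have "(\<lambda>n. \<integral>t. min \<bar>g n t\<bar> (d t) \<partial>M) \<longlonglongrightarrow> (\<integral>t. 0 \<partial>M)"
  proof (rule integral_dominated_convergence[OF _ _ d])
    show "AE t in M. (\<lambda>n. min \<bar>g n t\<bar> (d t)) \<longlonglongrightarrow> 0"
      using lim AE_space
    proof eventually_elim
      case (elim t)
      have "(\<lambda>n. min \<bar>g n t\<bar> (d t)) \<longlonglongrightarrow> min \<bar>0\<bar> (d t)"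
        by (intro tendsto_intros elim)
      then show ?case using nonneg(1)[OF elim(2)] by simp
    qed
    show "AE t in M. norm (min \<bar>g n t\<bar> (d t)) \<le> d t" for n
      using nonneg(1) by (intro AE_I2) auto
  qed auto
  then have *: "(\<lambda>n. (\<integral>t. min \<bar>g n t\<bar> (d t) \<partial>M) + (\<integral>t. e n t \<partial>M)) \<longlonglongrightarrow> 0"
    using e0 by (auto intro: tendsto_add_zero)
  show ?thesis
  proof (rule Lim_null_comparison[OF always_eventually *], rule allI)
    fix n
    have "\<bar>\<integral>t. g n t \<partial>M\<bar> \<le> (\<integral>t. \<bar>g n t\<bar> \<partial>M)" by (rule integral_abs_bound)
    \<comment> \<open>Where the minimum is the absolute value of \<open>g n t\<close>, adding
      \<open>e n t\<close> only increases it; where it is \<open>d t\<close>, this is the hypothesis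
      \<open>le\<close>.\<close>
    also have "\<dots> \<le> (\<integral>t. min \<bar>g n t\<bar> (d t) + e n t \<partial>M)"
      using g e min le nonneg(2)
      by (intro integral_mono) (auto simp: min_def)
    also have "\<dots> = (\<integral>t. min \<bar>g n t\<bar> (d t) \<partial>M) + (\<integral>t. e n t \<partial>M)"
      using min e by simp
    finally show "norm (\<integral>t. g n t \<partial>M) \<le> (\<integral>t. min \<bar>g n t\<bar> (d t) \<partial>M) + (\<integral>t. e n t \<partial>M)" by simp
  qed
qed

section \<open>Convergence of the images paired with a fixed function\<close>

text \<open>If \<open>y\<close> stayed at distance \<open>e\<close> from \<open>l\<close> infinitely
  often, those indices would enumerate a subsequence without any further subsequence tending to
  \<open>l\<close>. This fits L2 convergence, which yields convergence almost everywhere only along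
  subsequences.\<close>

lemma tendsto_subseqI:
  fixes y :: "nat \<Rightarrow> 'b::metric_space"
  assumes "\<And>s. strict_mono s \<Longrightarrow> \<exists>r::nat \<Rightarrow> nat. strict_mono r \<and> (\<lambda>n. y (s (r n))) \<longlonglongrightarrow> l"
  shows "y \<longlonglongrightarrow> l"
proof (rule ccontr)
  assume "\<not> y \<longlonglongrightarrow> l"
  then obtain e where "e > 0" "\<not> eventually (\<lambda>n. dist (y n) l < e) sequentially"
    by (auto simp: tendsto_iff)
  then have "infinite {n. \<not> dist (y n) l < e}"
    by (simp add: frequently_cofinite[symmetric] cofinite_eq_sequentially frequently_def)
  then obtain s :: "nat \<Rightarrow> nat" where s: "strict_mono s" "\<And>n. s n \<in> {n. \<not> dist (y n) l < e}"
    using infinite_enumerate by blast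
  with assms obtain r :: "nat \<Rightarrow> nat" where "(\<lambda>n. y (s (r n))) \<longlonglongrightarrow> l" by blast
  then have "eventually (\<lambda>n. dist (y (s (r n))) l < e) sequentially"
    using \<open>e > 0\<close> by (simp add: tendsto_iff)
  with s(2) show False by simp
qed

lemma superpos_inner_tendsto:
  fixes f :: "'a \<Rightarrow> 'b::{real_normed_vector, second_countable_topology} \<Rightarrow>
    'c::{real_inner, second_countable_topology}"
  assumes f: "\<And>x. (\<lambda>t. f t x) \<in> borel_measurable M"
    and demi: "\<And>t. t \<in> space M \<Longrightarrow> demicontinuous type_space type_space (f t)"
    and growth: "\<And>t x. t \<in> space M \<Longrightarrow> norm (f t x) \<le> a * norm x + b t"
    and "a \<ge> 0" and b: "b \<in> L2_fun M" "\<And>t. t \<in> space M \<Longrightarrow> b t \<ge> 0"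
    and x: "\<And>n. x n \<in> L2_fun M" and u: "u \<in> L2_fun M" and w: "w \<in> L2_fun M"
    and lim: "(\<lambda>n. \<integral>t. (norm (x n t - u t))\<^sup>2 \<partial>M) \<longlonglongrightarrow> 0"
  shows "(\<lambda>n. \<integral>t. inner (w t) (superpos f (x n) t - superpos f u t) \<partial>M) \<longlonglongrightarrow> 0"
proof (rule tendsto_subseqI)
  fix s :: "nat \<Rightarrow> nat" assume s: "strict_mono s"
  note fL2 = superpos_L2_fun[OF f demi growth b(1)]
  have diff: "(\<lambda>t. x n t - u t) \<in> L2_fun M" for n by (rule L2_fun_diff[OF x u])
  \<comment> \<open>L2 convergence is L1 convergence of the squared norms to 0, hence almost
    everywhere along a further subsequence.\<close>
  have "\<exists>r. strict_mono r \<and> (AE t in M. (\<lambda>n. (norm (x (s (r n)) t - u t))\<^sup>2) \<longlonglongrightarrow> 0)"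
  proof (rule tendsto_L1_AE_subseq)
    show "integrable M (\<lambda>t. (norm (x (s n) t - u t))\<^sup>2)" for n
      using diff[of "s n"] by (simp add: L2_fun_def)
    show "(\<lambda>n. \<integral>t. norm ((norm (x (s n) t - u t))\<^sup>2) \<partial>M) \<longlonglongrightarrow> 0"
      using LIMSEQ_subseq_LIMSEQ[OF lim s] by (simp add: o_def)
  qed
  then obtain r where r: "strict_mono r"
    and ae: "AE t in M. (\<lambda>n. (norm (x (s (r n)) t - u t))\<^sup>2) \<longlonglongrightarrow> 0" by blast
  define y where "y n = x (s (r n))" for n
  have y: "y n \<in> L2_fun M" for n by (simp add: y_def x)
  \<comment> \<open>Comparing \<open>y n\<close> with \<open>u\<close> in the growth bound leaves a
    majorant \<open>d\<close> independent of \<open>n\<close> and an excess \<open>e n\<close>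
    carrying \<open>y n - u\<close>. The outer \<open>norm\<close> in \<open>d\<close> makes it a
    product of norms of two L2 functions, hence integrable.\<close>
  define d where "d t = norm (w t) * norm (a *\<^sub>R norm (u t) + b t + norm (superpos f u t))" for t
  define e where "e n t = a * (norm (w t) * norm (y n t - u t))" for n t
  have "(\<lambda>n. \<integral>t. inner (w t) (superpos f (y n) t - superpos f u t) \<partial>M) \<longlonglongrightarrow> 0"
  proof (rule integral_tendsto_zero_dominated_excess)
    show "integrable M (\<lambda>t. inner (w t) (superpos f (y n) t - superpos f u t))" for n
      by (intro integrable_inner_L2 L2_fun_diff fL2 w y u)
    show "integrable M (e n)" for n
      unfolding e_def by (intro integrable_mult_right integrable_norm_mult_L2 L2_fun_diff w y u)
    show "integrable M d"
      unfolding d_def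
      by (intro integrable_norm_mult_L2 L2_fun_add L2_fun_scale L2_fun_norm fL2 w u b)
    show "AE t in M. (\<lambda>n. inner (w t) (superpos f (y n) t - superpos f u t)) \<longlonglongrightarrow> 0"
      using ae AE_space
    proof eventually_elim
      case (elim t)
      have "(\<lambda>n. sqrt ((norm (y n t - u t))\<^sup>2)) \<longlonglongrightarrow> sqrt 0"
        using elim(1) unfolding y_def by (rule tendsto_real_sqrt)
      then have "(\<lambda>n. y n t) \<longlonglongrightarrow> u t"
        by (simp add: tendsto_norm_zero_iff LIM_zero_iff)
      from demicontinuous_type_space_inner[OF demi[OF elim(2)] this, of "w t"]
      show ?case by (simp add: superpos_def inner_diff_right LIM_zero_iff)
    qed
    show "d t \<ge> 0" for t by (simp add: d_def)
    show "e n t \<ge> 0" for n t using \<open>a \<ge> 0\<close> by (simp add: e_def)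
    show "\<bar>inner (w t) (superpos f (y n) t - superpos f u t)\<bar> \<le> d t + e n t"
      if t: "t \<in> space M" for n t
    proof -
      have "norm (y n t) \<le> norm (u t) + norm (y n t - u t)"
        using norm_triangle_ineq[of "u t" "y n t - u t"] by simp
      then have "a * norm (y n t) \<le> a * norm (u t) + a * norm (y n t - u t)"
        using \<open>a \<ge> 0\<close> by (metis mult_left_mono distrib_left)
      then have "norm (superpos f (y n) t - superpos f u t) \<le>
          norm (a *\<^sub>R norm (u t) + b t + norm (superpos f u t)) + a * norm (y n t - u t)"
        using growth[OF t, of "y n t"]
          norm_triangle_ineq4[of "superpos f (y n) t" "superpos f u t"]
        by (simp add: superpos_def)
      then have "norm (w t) * norm (superpos f (y n) t - superpos f u t) \<le> d t + e n t"
        unfolding d_def e_def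
        by (metis mult_left_mono norm_ge_zero distrib_left mult.left_commute)
      then show ?thesis
        using Cauchy_Schwarz_ineq2[of "w t" "superpos f (y n) t - superpos f u t"] by simp
    qed
    \<comment> \<open>By Cauchy-Schwarz for the real functions \<open>norm (w t)\<close> and
      \<open>norm (y n t - u t)\<close>, this sequence dominates the integral of \<open>e n\<close>
      up to the factor \<open>a\<close>.\<close>
    have "(\<lambda>n. sqrt ((\<integral>t. (norm (w t))\<^sup>2 \<partial>M) * (\<integral>t. (norm (y n t - u t))\<^sup>2 \<partial>M))) \<longlonglongrightarrow>
        sqrt ((\<integral>t. (norm (w t))\<^sup>2 \<partial>M) * 0)"
      using LIMSEQ_subseq_LIMSEQ[OF LIMSEQ_subseq_LIMSEQ[OF lim s] r]
      by (intro tendsto_real_sqrt tendsto_mult tendsto_const) (simp add: o_def y_def)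
    then have root: "(\<lambda>n. sqrt ((\<integral>t. (norm (w t))\<^sup>2 \<partial>M) * (\<integral>t. (norm (y n t - u t))\<^sup>2 \<partial>M))) \<longlonglongrightarrow> 0"
      by simp
    have "(\<lambda>n. \<integral>t. norm (w t) * norm (y n t - u t) \<partial>M) \<longlonglongrightarrow> 0"
    proof (rule Lim_null_comparison[OF always_eventually root], rule allI)
      fix n
      have "(\<integral>t. norm (w t) * norm (y n t - u t) \<partial>M)\<^sup>2 \<le>
          (\<integral>t. (norm (w t))\<^sup>2 \<partial>M) * (\<integral>t. (norm (y n t - u t))\<^sup>2 \<partial>M)"
        using L2_Cauchy_Schwarz[OF L2_fun_norm[OF w] L2_fun_norm[OF L2_fun_diff[OF y u]]] by simp
      then show "norm (\<integral>t. norm (w t) * norm (y n t - u t) \<partial>M) \<le>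
          sqrt ((\<integral>t. (norm (w t))\<^sup>2 \<partial>M) * (\<integral>t. (norm (y n t - u t))\<^sup>2 \<partial>M))"
        by (simp add: real_le_rsqrt)
    qed
    then show "(\<lambda>n. \<integral>t. e n t \<partial>M) \<longlonglongrightarrow> 0"
      unfolding e_def by (simp add: tendsto_mult_right_zero)
  qed
  with r show "\<exists>r. strict_mono r \<and>
      (\<lambda>n. \<integral>t. inner (w t) (superpos f (x (s (r n))) t - superpos f u t) \<partial>M) \<longlonglongrightarrow> 0"
    by (auto simp: y_def)
qed

section \<open>Passage to equivalence classes\<close>

lemma L2_carrierE:
  assumes "U \<in> vcarrier (L2_space M)"
  obtains u where "u \<in> L2_fun M" "U = L2_class M u"
  using assms by (auto simp: L2_space_def L2_class_def elim: quotientE)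

lemma L2_diff_class:
  assumes "u \<in> L2_fun M" "v \<in> L2_fun M"
  shows "vdiff (L2_space M) (L2_class M u) (L2_class M v) = L2_class M (\<lambda>t. u t - v t)"
  using L2_add_class[OF assms(1) L2_fun_scale[OF assms(2), of "-1"]]
  by (simp add: vdiff_def L2_scale_class[OF assms(2)])

lemma superpos_respects:
  fixes f :: "'a \<Rightarrow> 'b::{real_normed_vector, second_countable_topology} \<Rightarrow>
    'c::{real_normed_vector, second_countable_topology}"
  assumes "superpos f \<in> L2_fun M \<rightarrow> L2_fun M"
  shows "(\<lambda>u. L2_class M (superpos f u)) respects L2_rel M"
proof (rule congruentI)
  fix u v :: "'a \<Rightarrow> 'b" assume uv: "(u, v) \<in> L2_rel M"
  then have "AE t in M. u t = v t" by (simp add: L2_rel_def)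
  then have "AE t in M. superpos f u t = superpos f v t"
    by eventually_elim (simp add: superpos_def)
  with uv assms show "L2_class M (superpos f u) = L2_class M (superpos f v)"
    by (intro L2_class_eqI) (auto simp: L2_rel_def)
qed

text \<open>Since the class of the image is the same for all representatives, the union defining
  \<open>superpos_op\<close> is over equal sets and can be computed on any one of them.\<close>

lemma superpos_op_class:
  fixes f :: "'a \<Rightarrow> 'b::{real_normed_vector, second_countable_topology} \<Rightarrow>
    'c::{real_normed_vector, second_countable_topology}"
  assumes "superpos f \<in> L2_fun M \<rightarrow> L2_fun M" "u \<in> L2_fun M"
  shows "superpos_op M f (L2_class M u) = L2_class M (superpos f u)"
  unfolding superpos_op_def L2_class_def[of M u]
  using UN_equiv_class[OF equiv_L2_rel superpos_respects[OF assms(1)] assms(2)] .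

theorem lemma4p2:
  fixes f :: "real \<Rightarrow> 'h::{real_inner, complete_space, second_countable_topology} \<Rightarrow> 'h"
    and T :: real
  assumes "T > 0"
    and F1: "\<And>x. (\<lambda>t. f t x) \<in> borel_measurable (lebesgue_on {0..T})"
    and F2: "\<And>t. t \<in> {0..T} \<Longrightarrow> demicontinuous type_space type_space (f t)"
    and F3: "\<exists>a>0. \<exists>b\<in>L2_fun (lebesgue_on {0..T}). (\<forall>t\<in>{0..T}. b t \<ge> 0) \<and>
               (\<forall>t\<in>{0..T}. \<forall>x. norm (f t x) \<le> a * norm x + b t)"
  shows "superpos f \<in> L2_fun (lebesgue_on {0..T}) \<rightarrow> L2_fun (lebesgue_on {0..T}) \<and>
         (\<lambda>u. L2_class (lebesgue_on {0..T}) (superpos f u)) respects L2_rel (lebesgue_on {0..T}) \<and>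
         (\<forall>B. vbounded (L2_space (lebesgue_on {0..T})) B \<longrightarrow>
              vbounded (L2_space (lebesgue_on {0..T})) (superpos_op (lebesgue_on {0..T}) f ` B)) \<and>
         demicontinuous (L2_space (lebesgue_on {0..T})) (L2_space (lebesgue_on {0..T}))
           (superpos_op (lebesgue_on {0..T}) f)"
proof -
  define M where "M = lebesgue_on {0..T}"
  have sp: "space M = {0..T}" by (simp add: M_def)
  obtain a b where ab: "a > 0" "b \<in> L2_fun M" "\<And>t. t \<in> space M \<Longrightarrow> b t \<ge> 0"
    "\<And>t x. t \<in> space M \<Longrightarrow> norm (f t x) \<le> a * norm x + b t"
    using F3 unfolding sp M_def[symmetric] by auto
  have f: "\<And>x. (\<lambda>t. f t x) \<in> borel_measurable M" using F1 by (simp add: M_def)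
  have demi: "\<And>t. t \<in> space M \<Longrightarrow> demicontinuous type_space type_space (f t)"
    using F2 by (simp add: sp)
  have map: "superpos f \<in> L2_fun M \<rightarrow> L2_fun M"
    using superpos_L2_fun[OF f demi ab(4) ab(2)] by blast
  have op: "superpos_op M f (L2_class M u) = L2_class M (superpos f u)" if "u \<in> L2_fun M" for u
    using superpos_op_class[OF map that] .
  have op_carrier: "superpos_op M f U \<in> vcarrier (L2_space M)"
    if "U \<in> vcarrier (L2_space M)" for U
    using that map by (elim L2_carrierE) (auto simp: op intro: L2_class_carrier)
  have bounded: "vbounded (L2_space M) (superpos_op M f ` B)" if B: "vbounded (L2_space M) B" for B
  proof -
    obtain R where R: "\<And>U. U \<in> B \<Longrightarrow> vnorm (L2_space M) U \<le> R"
      using B by (auto simp: vbounded_def)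
    \<comment> \<open>The constant is the bound of \<open>superpos_L2_bound\<close> with
      \<open>R\<^sup>2\<close> in place of the squared norm of a representative.\<close>
    have "vnorm (L2_space M) (superpos_op M f U) \<le> sqrt (2 * a\<^sup>2 * R\<^sup>2 + 2 * (\<integral>t. (b t)\<^sup>2 \<partial>M))"
      if "U \<in> B" for U
    proof -
      have "U \<in> vcarrier (L2_space M)" using B that by (auto simp: vbounded_def)
      then obtain u where u: "u \<in> L2_fun M" "U = L2_class M u" by (rule L2_carrierE)
      have "sqrt (\<integral>t. (norm (u t))\<^sup>2 \<partial>M) \<le> R" using R[OF that] u by (simp add: L2_norm_class)
      then have "(\<integral>t. (norm (u t))\<^sup>2 \<partial>M) \<le> R\<^sup>2" by (rule sqrt_le_D)
      then have "2 * a\<^sup>2 * (\<integral>t. (norm (u t))\<^sup>2 \<partial>M) \<le> 2 * a\<^sup>2 * R\<^sup>2" by (intro mult_left_mono) auto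
      with superpos_L2_bound[OF ab(4) ab(2) u(1)] map u(1)
      have "(\<integral>t. (norm (superpos f u t))\<^sup>2 \<partial>M) \<le> 2 * a\<^sup>2 * R\<^sup>2 + 2 * (\<integral>t. (b t)\<^sup>2 \<partial>M)" by force
      then show ?thesis using u map by (simp add: op L2_norm_class Pi_iff)
    qed
    moreover have "superpos_op M f ` B \<subseteq> vcarrier (L2_space M)"
      using B op_carrier by (auto simp: vbounded_def)
    ultimately show ?thesis unfolding vbounded_def by blast
  qed
  have "weakly_converges (L2_space M) (\<lambda>n. superpos_op M f (X n)) (superpos_op M f U)"
    if conv: "strongly_converges (L2_space M) X U" for X U
    unfolding weakly_converges_def
  proof (intro conjI ballI)
    have X: "\<And>n. X n \<in> vcarrier (L2_space M)" and U: "U \<in> vcarrier (L2_space M)"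
      using conv by (auto simp: strongly_converges_def)
    then show "range (\<lambda>n. superpos_op M f (X n)) \<subseteq> vcarrier (L2_space M)"
      and "superpos_op M f U \<in> vcarrier (L2_space M)" using op_carrier by blast+
    obtain u where u: "u \<in> L2_fun M" "U = L2_class M u" using U by (rule L2_carrierE)
    have "\<exists>x. x \<in> L2_fun M \<and> X n = L2_class M x" for n
      using X[of n] by (rule L2_carrierE) blast
    then obtain x where x: "\<And>n. x n \<in> L2_fun M" "\<And>n. X n = L2_class M (x n)" by metis
    note fL2 = funcset_mem[OF map]
    have "(\<lambda>n. sqrt (\<integral>t. (norm (x n t - u t))\<^sup>2 \<partial>M)) \<longlonglongrightarrow> 0"
      using conv x u
      by (simp add: strongly_converges_def L2_diff_class L2_norm_class[OF L2_fun_diff])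
    then have "(\<lambda>n. (sqrt (\<integral>t. (norm (x n t - u t))\<^sup>2 \<partial>M))\<^sup>2) \<longlonglongrightarrow> 0\<^sup>2" by (rule tendsto_power)
    then have lim: "(\<lambda>n. \<integral>t. (norm (x n t - u t))\<^sup>2 \<partial>M) \<longlonglongrightarrow> 0" by simp
    fix \<phi> :: "(real \<Rightarrow> 'h) set \<Rightarrow> real" assume \<phi>: "\<phi> \<in> dual (L2_space M)"
    \<comment> \<open>The approximate Riesz representation concerns functions, so \<phi> is pulled
      back from classes to representatives.\<close>
    define \<psi> where "\<psi> v = \<phi> (L2_class M v)" for v
    have add: "\<psi> (\<lambda>t. v t + v' t) = \<psi> v + \<psi> v'" if "v \<in> L2_fun M" "v' \<in> L2_fun M" for v v'
      using \<phi> that L2_class_carrier[OF that(1)] L2_class_carrier[OF that(2)]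
      by (simp add: dual_def \<psi>_def L2_add_class[OF that, symmetric])
    have scale: "\<psi> (\<lambda>t. c *\<^sub>R v t) = c * \<psi> v" if "v \<in> L2_fun M" for c v
      using \<phi> L2_class_carrier[OF that]
      by (simp add: dual_def \<psi>_def L2_scale_class[OF that, symmetric])
    obtain C where C: "\<forall>V\<in>vcarrier (L2_space M). \<bar>\<phi> V\<bar> \<le> C * vnorm (L2_space M) V"
      using \<phi> unfolding dual_def by blast
    have bound: "\<bar>\<psi> v\<bar> \<le> C * sqrt (\<integral>t. (norm (v t))\<^sup>2 \<partial>M)" if "v \<in> L2_fun M" for v
      using bspec[OF C L2_class_carrier[OF that]] by (simp add: \<psi>_def L2_norm_class[OF that])
    define z where "z n t = superpos f (x n) t - superpos f u t" for n t
    have z: "z n \<in> L2_fun M" for n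
      using L2_fun_diff[OF fL2[OF x(1)] fL2[OF u(1)]] by (simp add: z_def[abs_def])
    have \<psi>z: "\<psi> (z n) = \<phi> (superpos_op M f (X n)) - \<phi> (superpos_op M f U)" for n
      \<comment> \<open>The difference is treated as a sum with the multiple by -1, so additivity
        and homogeneity of \<psi> suffice.\<close>
      using add[OF fL2[OF x(1)[of n]] L2_fun_scale[OF fL2[OF u(1)], of "-1"]] scale[OF fL2[OF u(1)], of "-1"]
      by (simp add: z_def[abs_def] \<psi>_def x u op)
    obtain L where L: "\<And>n. (\<integral>t. (norm (x n t - u t))\<^sup>2 \<partial>M) \<le> L"
      using convergent_imp_Bseq[OF convergentI[OF lim]] by (auto simp: Bseq_def)
    \<comment> \<open>The constants follow the chain of bounds: splitting \<open>x n\<close> into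
      \<open>x n - u\<close> and \<open>u\<close>, then the growth estimate (\<open>D\<close> plus
      the term in \<open>b\<close>), then subtracting \<open>superpos f u\<close>
      (\<open>Q\<close>). The maximum with 1 makes \<open>K\<close> positive, so that it can be
      divided by.\<close>
    define D where "D = 2 * a\<^sup>2 * (2 * L + 2 * (\<integral>t. (norm (u t))\<^sup>2 \<partial>M))"
    define Q where "Q = 2 * (D + 2 * (\<integral>t. (b t)\<^sup>2 \<partial>M)) +
      2 * (\<integral>t. (norm (superpos f u t))\<^sup>2 \<partial>M)"
    define K where "K = sqrt (max Q 1)"
    have "K > 0" by (simp add: K_def)
    have K: "sqrt (\<integral>t. (norm (z n t))\<^sup>2 \<partial>M) \<le> K" for n
    proof -
      have "(\<integral>t. (norm (x n t))\<^sup>2 \<partial>M) \<le> 2 * L + 2 * (\<integral>t. (norm (u t))\<^sup>2 \<partial>M)"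
        using L2_integral_add_le[OF L2_fun_diff[OF x(1)[of n] u(1)] u(1)] L[of n] by simp
      then have "2 * a\<^sup>2 * (\<integral>t. (norm (x n t))\<^sup>2 \<partial>M) \<le> D"
        unfolding D_def by (rule mult_left_mono) simp
      then have fx: "(\<integral>t. (norm (superpos f (x n) t))\<^sup>2 \<partial>M) \<le> D + 2 * (\<integral>t. (b t)\<^sup>2 \<partial>M)"
        by (intro order_trans[OF superpos_L2_bound[OF ab(4) ab(2) x(1) fL2[OF x(1)]]] add_right_mono)
      have "(\<integral>t. (norm (z n t))\<^sup>2 \<partial>M) \<le>
          2 * (\<integral>t. (norm (superpos f (x n) t))\<^sup>2 \<partial>M) + 2 * (\<integral>t. (norm (superpos f u t))\<^sup>2 \<partial>M)"
        using L2_integral_add_le[OF fL2[OF x(1)[of n]] L2_fun_scale[OF fL2[OF u(1)], of "-1"]]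
        by (simp add: z_def)
      also have "\<dots> \<le> Q"
        unfolding Q_def using fx by (intro add_right_mono mult_left_mono) simp_all
      finally have "(\<integral>t. (norm (z n t))\<^sup>2 \<partial>M) \<le> Q" .
      then show ?thesis by (simp add: K_def)
    qed
    have "(\<lambda>n. \<psi> (z n)) \<longlonglongrightarrow> 0"
    proof (rule LIMSEQ_I)
      fix r :: real assume "r > 0"
      \<comment> \<open>With this accuracy \<open>w\<close> represents \<psi> up to r/2 on every
        \<open>z n\<close> at once. As \<open>w\<close> is fixed before \<open>N\<close>, the
        pairing with \<open>w\<close> can supply the other half.\<close>
      then have "r / (2 * K) > 0" using \<open>K > 0\<close> by simp
      from L2_approx_Riesz[OF add scale bound this] obtain w where w: "w \<in> L2_fun M"
        and close: "\<And>v. v \<in> L2_fun M \<Longrightarrow>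
          \<bar>(\<integral>t. inner (w t) (v t) \<partial>M) - \<psi> v\<bar> \<le> r / (2 * K) * sqrt (\<integral>t. (norm (v t))\<^sup>2 \<partial>M)"
        by blast
      have "(\<lambda>n. \<integral>t. inner (w t) (z n t) \<partial>M) \<longlonglongrightarrow> 0"
        unfolding z_def
        by (rule superpos_inner_tendsto[OF f demi ab(4) less_imp_le[OF ab(1)] ab(2,3) x(1) u(1) w lim])
      then obtain N where N: "\<And>n. n \<ge> N \<Longrightarrow> \<bar>\<integral>t. inner (w t) (z n t) \<partial>M\<bar> < r / 2"
        using LIMSEQ_D[of _ 0 "r / 2"] \<open>r > 0\<close> by fastforce
      have "\<bar>\<psi> (z n)\<bar> < r" if "n \<ge> N" for n
      proof -
        have "r / (2 * K) * sqrt (\<integral>t. (norm (z n t))\<^sup>2 \<partial>M) \<le> r / (2 * K) * K"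
          using K \<open>K > 0\<close> \<open>r > 0\<close> by (intro mult_left_mono) auto
        also have "\<dots> = r / 2" using \<open>K > 0\<close> by simp
        finally show ?thesis using close[OF z[of n]] N[OF that] by linarith
      qed
      then show "\<exists>N. \<forall>n\<ge>N. norm (\<psi> (z n) - 0) < r" by auto
    qed
    then show "(\<lambda>n. \<phi> (superpos_op M f (X n))) \<longlonglongrightarrow> \<phi> (superpos_op M f U)"
      by (simp add: \<psi>z LIM_zero_iff)
  qed
  then have "demicontinuous (L2_space M) (L2_space M) (superpos_op M f)"
    using op_carrier by (auto simp: demicontinuous_def)
  with map superpos_respects[OF map] bounded show ?thesis unfolding M_def by blast
qed

end
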